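(* Let $(C_N,w,v_1)$ with $N\geq 3$ be an instance of Adjacent Nim with $w:V\rightarrow \mathbb{N}_{>1}$. \begin{itemize} \item If $N$ is odd, then $(C_N,w,v_1)$ is an $\mathcal{N}$ position. \item If $N$ is even, then $(C_N,w,v_1)$ is an $\mathcal{N}$ position iff $\min\{\underset{1\leq i \leq N}{\operatorname{argmin}}\;w(v_i)\}$ is even. \end{itemize}
   Context: Directed Vertexnim: let $G=(V,E)$ be a strongly connected digraph, $w:V\rightarrow \mathbb{N}_{>0}$ a weight function on the vertices, and $u\in V$ the starting current vertex. Two players alternately decrease the value (weight) of the current vertex $u$ by a positive amount and then choose an out-neighbour of $u$ as the new current vertex. When the weight of a vertex $v$ is set to $0$, $v$ is removed and every pair of arcs $(p,v),(v,s)$ (with $p,s$ not necessarily distinct) is replaced by an arc $(p,s)$. The game ends when $G$ is empty; the player making the last move wins. Adjacent Nim is Directed Vertexnim played on an elementary circuit $C_N=(v_1,\dots,v_N)$ with arcs $(v_i,v_{i+1})$ for $1\le i<N$ and $(v_N,v_1)$; the starting current vertex is $v_1$. A $\mathcal{P}$ position is one from which the second player has a winning strategy, an $\mathcal{N}$ position one from which the first player (the player to move) can win. *)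

theory Defs
  imports "Graph_Theory.Graph_Theory"
begin

subsection \<open>Directed Vertexnim\<close>

record 'v position =
  graph :: "'v pair_pre_digraph"
  weight :: "'v \<Rightarrow> nat"
  current :: 'v

definition vertexnim_instance :: "'v position \<Rightarrow> bool" where
  "vertexnim_instance x \<longleftrightarrow>
     pair_fin_digraph (graph x) \<and> strongly_connected (with_proj (graph x)) \<and>
     (\<forall>v \<in> pverts (graph x). 0 < weight x v) \<and> current x \<in> pverts (graph x)"

definition remove_vertex :: "'v \<Rightarrow> 'v pair_pre_digraph \<Rightarrow> 'v pair_pre_digraph" where
  "remove_vertex v G =
     \<lparr> pverts = pverts G - {v},
       parcs = {(p, s). p \<noteq> v \<and> s \<noteq> v \<and>
                  ((p, s) \<in> parcs G \<or> (p, v) \<in> parcs G \<and> (v, s) \<in> parcs G)} \<rparr>"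

text \<open>
  A vertex whose weight becomes 0 leaves the graph, so the next current vertex is one of its
  out-neighbours other than itself; removing the last vertex ends the game, and the field
  \<open>current\<close> is then meaningless.
\<close>

inductive move :: "'v position \<Rightarrow> 'v position \<Rightarrow> bool" where
  decrease: "\<lbrakk> u \<in> pverts G; 0 < k; k < w u; (u, v) \<in> parcs G \<rbrakk> \<Longrightarrow>
    move \<lparr> graph = G, weight = w, current = u \<rparr>
         \<lparr> graph = G, weight = w(u := k), current = v \<rparr>"
| remove: "\<lbrakk> u \<in> pverts G; 0 < w u; (u, v) \<in> parcs G; v \<noteq> u \<rbrakk> \<Longrightarrow>
    move \<lparr> graph = G, weight = w, current = u \<rparr>
         \<lparr> graph = remove_vertex u G, weight = w(u := 0), current = v \<rparr>"
| remove_last: "\<lbrakk> pverts G = {u}; 0 < w u \<rbrakk> \<Longrightarrow>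
    move \<lparr> graph = G, weight = w, current = u \<rparr>
         \<lparr> graph = remove_vertex u G, weight = w(u := 0), current = u \<rparr>"

definition game_over :: "'v position \<Rightarrow> bool" where
  "game_over x \<longleftrightarrow> pverts (graph x) = {}"

subsection \<open>Strategies and outcomes\<close>

text \<open>
  A (partial) play is the nonempty list of the positions visited so far, so a play of length
  \<open>n\<close> comprises \<open>n - 1\<close> moves. There are no infinite plays, since every move lowers the total
  weight (lemma \<open>move_weight_less\<close>); hence finite lists suffice to define winning.
\<close>

datatype player = First | Second

definition play :: "'v position \<Rightarrow> 'v position list \<Rightarrow> bool" where
  "play x xs \<longleftrightarrow> xs \<noteq> [] \<and> hd xs = x \<and> successively move xs"

definition to_move :: "'v position list \<Rightarrow> player" where
  "to_move xs = (if odd (length xs) then First else Second)"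

definition follows ::
    "player \<Rightarrow> ('v position list \<Rightarrow> 'v position) \<Rightarrow> 'v position list \<Rightarrow> bool" where
  "follows A \<sigma> xs \<longleftrightarrow>
     (\<forall>k. 0 < k \<and> k < length xs \<and> to_move (take k xs) = A \<longrightarrow> xs ! k = \<sigma> (take k xs))"

text \<open>
  At the end of a play, \<open>to_move xs \<noteq> A\<close> says that \<open>A\<close> made the last move.
\<close>

definition winning_strategy ::
    "player \<Rightarrow> ('v position list \<Rightarrow> 'v position) \<Rightarrow> 'v position \<Rightarrow> bool" where
  "winning_strategy A \<sigma> x \<longleftrightarrow>
     (\<forall>xs. play x xs \<and> follows A \<sigma> xs \<longrightarrow>
        (if game_over (last xs) then to_move xs \<noteq> A
         else to_move xs = A \<longrightarrow> move (last xs) (\<sigma> xs)))"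

definition N_position :: "'v position \<Rightarrow> bool" where
  "N_position x \<longleftrightarrow> (\<exists>\<sigma>. winning_strategy First \<sigma> x)"

definition P_position :: "'v position \<Rightarrow> bool" where
  "P_position x \<longleftrightarrow> (\<exists>\<sigma>. winning_strategy Second \<sigma> x)"

subsection \<open>Adjacent Nim\<close>

definition circuit :: "nat \<Rightarrow> nat pair_pre_digraph" where
  "circuit N = \<lparr> pverts = {1..N}, parcs = {(i, i + 1) | i. 1 \<le> i \<and> i < N} \<union> {(N, 1)} \<rparr>"

definition adjacent_nim :: "nat \<Rightarrow> (nat \<Rightarrow> nat) \<Rightarrow> nat position" where
  "adjacent_nim N w = \<lparr> graph = circuit N, weight = w, current = 1 \<rparr>"

subsection \<open>Basic facts\<close>

lemma strongly_connected_circuit: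
  assumes "1 \<le> N"
  shows "strongly_connected (with_proj (circuit N))"
proof -
  let ?reach = "\<lambda>i j. (i, j) \<in> rtrancl_on {1..N} (parcs (circuit N))"
  have up: "?reach i j" if "i \<in> {1..N}" "i \<le> j" "j \<le> N" for i j
    using that(2,3)
  proof (induction rule: dec_induct)
    case base
    show ?case using that(1) by (rule rtrancl_on_refl)
  next
    case (step n)
    then have "(n, Suc n) \<in> parcs (circuit N)" using that(1) by (auto simp: circuit_def)
    with step show ?case by (auto intro: rtrancl_on_into_rtrancl_on)
  qed
  have "?reach i j" if "i \<in> {1..N}" "j \<in> {1..N}" for i j
  proof -
    have "?reach i N" using up[of i N] that by simp
    moreover have "(N, 1) \<in> parcs (circuit N)" by (simp add: circuit_def)
    ultimately have "?reach i 1" using assms by (auto intro: rtrancl_on_into_rtrancl_on)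
    moreover have "?reach 1 j" using up[of 1 j] that by simp
    ultimately show ?thesis by (rule rtrancl_on_trans)
  qed
  then show ?thesis
    using assms by (auto simp: strongly_connected_def reachable_def circuit_def)
qed

lemma vertexnim_instance_adjacent_nim:
  assumes "1 \<le> N" and "\<forall>i \<in> {1..N}. 0 < w i"
  shows "vertexnim_instance (adjacent_nim N w)"
proof -
  have "parcs (circuit N) \<subseteq> {1..N} \<times> {1..N}"
    using assms(1) by (auto simp: circuit_def)
  then have "pair_fin_digraph (circuit N)"
    by unfold_locales (auto simp: circuit_def intro: finite_subset)
  with assms strongly_connected_circuit[of N] show ?thesis
    by (auto simp: vertexnim_instance_def adjacent_nim_def circuit_def)
qed

lemma move_weight_less:
  assumes "move x y" and "finite (pverts (graph x))"
  shows "sum (weight y) (pverts (graph y)) < sum (weight x) (pverts (graph x))"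
  using assms
proof (induction rule: move.induct)
  case (decrease u G k w v)
  then show ?case by (auto simp: sum.remove[of _ u] intro!: add_less_le_mono sum_mono)
next
  case (remove u G w v)
  then show ?case by (auto simp: remove_vertex_def sum.remove[of _ u])
next
  case (remove_last G u w)
  then show ?case by (simp add: remove_vertex_def)
qed

lemma not_game_over_if_move: "move x y \<Longrightarrow> \<not> game_over x"
  by (induction rule: move.induct) (auto simp: game_over_def)

lemma play_singleton: "play x [x]"
  by (simp add: play_def)

lemma play_Cons: "move x y \<Longrightarrow> play y ys \<Longrightarrow> play x (x # ys)"
  by (cases ys) (auto simp: play_def)

lemma play_cases:
  assumes "play x xs"
  obtains "xs = [x]" | y ys where "xs = x # ys" "move x y" "play y ys"
  using assms by (cases xs; cases "tl xs") (auto simp: play_def)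

fun other :: "player \<Rightarrow> player" where
  "other First = Second"
| "other Second = First"

lemma to_move_Cons: "to_move (x # xs) = other (to_move xs)"
  by (simp add: to_move_def)

lemma other_eq_iff: "other A = B \<longleftrightarrow> A = other B"
  by (cases A; cases B) auto

lemma follows_singleton: "follows A \<sigma> [x]"
  by (simp add: follows_def)

lemma follows_Cons:
  assumes "xs \<noteq> []"
  shows "follows A \<sigma> (x # xs) \<longleftrightarrow>
    (A = First \<longrightarrow> hd xs = \<sigma> [x]) \<and> follows (other A) (\<lambda>h. \<sigma> (x # h)) xs"
proof -
  have *: "(\<forall>k. P k) \<longleftrightarrow> P 0 \<and> P (Suc 0) \<and> (\<forall>k>0. P (Suc k))" for P :: "nat \<Rightarrow> bool"
    by (metis not0_implies_Suc not_gr_zero)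
  show ?thesis
    unfolding follows_def
    by (subst *) (use assms in \<open>auto simp: to_move_Cons other_eq_iff to_move_def[of "[]"] hd_conv_nth\<close>)
qed

theorem N_position_iff: "N_position x \<longleftrightarrow> (\<exists>y. move x y \<and> P_position y)"
proof
  assume "N_position x"
  then obtain \<sigma> where \<sigma>: "winning_strategy First \<sigma> x" by (auto simp: N_position_def)
  have m: "move x (\<sigma> [x])"
    using \<sigma>[unfolded winning_strategy_def, rule_format, of "[x]"]
    by (auto simp: play_singleton follows_singleton to_move_def split: if_splits)
  have "winning_strategy Second (\<lambda>h. \<sigma> (x # h)) (\<sigma> [x])"
    unfolding winning_strategy_def
  proof (intro allI impI)
    fix ys assume ys: "play (\<sigma> [x]) ys \<and> follows Second (\<lambda>h. \<sigma> (x # h)) ys"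
    then have "ys \<noteq> []" "hd ys = \<sigma> [x]" by (auto simp: play_def)
    with ys m \<sigma>[unfolded winning_strategy_def, rule_format, of "x # ys"]
    show "if game_over (last ys) then to_move ys \<noteq> Second
          else to_move ys = Second \<longrightarrow> move (last ys) (\<sigma> (x # ys))"
      by (simp add: play_Cons follows_Cons to_move_Cons other_eq_iff split: if_splits)
  qed
  with m show "\<exists>y. move x y \<and> P_position y" by (auto simp: P_position_def)
next
  assume "\<exists>y. move x y \<and> P_position y"
  then obtain y \<sigma> where m: "move x y" and \<sigma>: "winning_strategy Second \<sigma> y"
    by (auto simp: P_position_def)
  define \<tau> where "\<tau> h = (if h = [x] then y else \<sigma> (tl h))" for h
  have "winning_strategy First \<tau> x"
    unfolding winning_strategy_def
  proof (intro allI impI, elim conjE)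
    fix xs assume p: "play x xs" and f: "follows First \<tau> xs"
    from p show "if game_over (last xs) then to_move xs \<noteq> First
                 else to_move xs = First \<longrightarrow> move (last xs) (\<tau> xs)"
    proof (cases rule: play_cases)
      case 1
      with m show ?thesis by (simp add: not_game_over_if_move \<tau>_def)
    next
      case (2 z ys)
      then have ne: "ys \<noteq> []" "hd ys = z" by (auto simp: play_def)
      with f 2 have "z = y" "follows Second (\<lambda>h. \<tau> (x # h)) ys"
        by (auto simp: follows_Cons \<tau>_def)
      then have "follows Second \<sigma> ys"
        by (auto simp: follows_def \<tau>_def)
      with \<open>z = y\<close> 2 ne \<sigma>[unfolded winning_strategy_def, rule_format, of ys] show ?thesis
        by (simp add: to_move_Cons other_eq_iff \<tau>_def split: if_splits)
    qed
  qed
  then show "N_position x" by (auto simp: N_position_def)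
qed

theorem P_position_iff: "P_position x \<longleftrightarrow> (\<forall>y. move x y \<longrightarrow> N_position y)"
proof
  assume "P_position x"
  then obtain \<sigma> where \<sigma>: "winning_strategy Second \<sigma> x" by (auto simp: P_position_def)
  have "winning_strategy First (\<lambda>h. \<sigma> (x # h)) y" if m: "move x y" for y
    unfolding winning_strategy_def
  proof (intro allI impI)
    fix ys assume ys: "play y ys \<and> follows First (\<lambda>h. \<sigma> (x # h)) ys"
    then have "ys \<noteq> []" by (auto simp: play_def)
    with ys m \<sigma>[unfolded winning_strategy_def, rule_format, of "x # ys"]
    show "if game_over (last ys) then to_move ys \<noteq> First
          else to_move ys = First \<longrightarrow> move (last ys) (\<sigma> (x # ys))"
      by (simp add: play_Cons follows_Cons to_move_Cons other_eq_iff split: if_splits)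
  qed
  then show "\<forall>y. move x y \<longrightarrow> N_position y" by (auto simp: N_position_def)
next
  assume "\<forall>y. move x y \<longrightarrow> N_position y"
  then obtain \<sigma> where \<sigma>: "\<And>y. move x y \<Longrightarrow> winning_strategy First (\<sigma> y) y"
    unfolding N_position_def by metis
  define \<tau> where "\<tau> h = \<sigma> (hd (tl h)) (tl h)" for h
  have "winning_strategy Second \<tau> x"
    unfolding winning_strategy_def
  proof (intro allI impI, elim conjE)
    fix xs assume p: "play x xs" and f: "follows Second \<tau> xs"
    from p show "if game_over (last xs) then to_move xs \<noteq> Second
                 else to_move xs = Second \<longrightarrow> move (last xs) (\<tau> xs)"
    proof (cases rule: play_cases)
      case 1
      then show ?thesis by (simp add: to_move_def)
    next
      case (2 y ys)
      then have ne: "ys \<noteq> []" "hd ys = y" by (auto simp: play_def)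
      with f 2 have "follows First (\<lambda>h. \<tau> (x # h)) ys"
        by (auto simp: follows_Cons)
      then have "follows First (\<sigma> y) ys"
        using ne by (auto simp: follows_def \<tau>_def)
      with 2 ne \<sigma>[OF 2(2), unfolded winning_strategy_def, rule_format, of ys] show ?thesis
        by (simp add: to_move_Cons other_eq_iff \<tau>_def split: if_splits)
    qed
  qed
  then show "P_position x" by (auto simp: P_position_def)
qed

end

theory Submission
  imports Defs
begin

text \<open>
  A circuit with its weights is a list of positive numbers read from the current vertex: a move
  shortens the list at the front and appends what remains of the first entry, if anything.

  Suppose a player faces \<open>b\<^sub>1, \<dots>, b\<^sub>2\<^sub>n, 1\<close> with all \<open>b\<^sub>i \<ge> 2\<close> and \<open>n \<ge> 1\<close>. The opponent plays the even-numbered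
  entries and answers a removal by a removal and any other move by leaving 1, except that the last
  answer is chosen by parity. Since the first player must then remove the 1, the opponent moves in a
  list in which every second entry, to be played by the first player, is 1. Those are forced
  removals, so the opponent decides the parity of the remaining game and wins. Hence an odd circuit
  with weights at least 2 is won by reducing the first weight to 1, and in an even circuit with
  weights at least 2 whoever first leaves 0 or 1 loses. There each player always plays the same
  vertices, and the one who does not own the leftmost minimum wins by decrementing by 1.
\<close>

section \<open>The game on lists\<close>

inductive lstep :: "nat list \<Rightarrow> nat list \<Rightarrow> bool" where
  lstep_decrease: "0 < k \<Longrightarrow> k < a \<Longrightarrow> lstep (a # l) (l @ [k])"
| lstep_remove: "0 < a \<Longrightarrow> lstep (a # l) l"

text \<open>Winning and losing are defined as least predicates, so each derivation is a finite
  argument and outcomes can be transferred by rule induction.\<close>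

inductive lwin :: "nat list \<Rightarrow> bool" and llose :: "nat list \<Rightarrow> bool" where
  lwinI: "lstep l l' \<Longrightarrow> llose l' \<Longrightarrow> lwin l"
| lloseI: "(\<And>l'. lstep l l' \<Longrightarrow> lwin l') \<Longrightarrow> llose l"

lemma lwin_decrease: "llose (l @ [k]) \<Longrightarrow> 0 < k \<Longrightarrow> k < a \<Longrightarrow> lwin (a # l)"
  by (rule lwinI[OF lstep_decrease])

lemma lwin_remove: "llose l \<Longrightarrow> 0 < a \<Longrightarrow> lwin (a # l)"
  by (rule lwinI[OF lstep_remove])

lemma llose_Cons:
  assumes "\<And>k. 0 < k \<Longrightarrow> k < a \<Longrightarrow> lwin (l @ [k])" and "lwin l"
  shows "llose (a # l)"
  by (rule lloseI) (use assms in \<open>auto elim: lstep.cases\<close>)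

lemma llose_Nil: "llose []"
  by (rule lloseI) (auto elim: lstep.cases)

lemma llose_Cons_1: "lwin l \<Longrightarrow> llose (1 # l)"
  by (rule llose_Cons) auto

lemma replicate_1:
  shows "odd n \<Longrightarrow> lwin (replicate n 1)" and "even n \<Longrightarrow> llose (replicate n 1)"
  by (induction n) (auto intro: llose_Nil llose_Cons_1[simplified] lwin_remove)

section \<open>Lists in which every second entry is 1\<close>

fun alternating :: "nat list \<Rightarrow> bool" where
  "alternating [] \<longleftrightarrow> True"
| "alternating [x] \<longleftrightarrow> 0 < x"
| "alternating (x # y # l) \<longleftrightarrow> 0 < x \<and> y = 1 \<and> alternating l"

lemma alternating_append:
  "alternating l \<Longrightarrow> even (length l) \<Longrightarrow> alternating l' \<Longrightarrow> alternating (l @ l')"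
  by (induction l rule: alternating.induct) auto

lemma alternating_pos: "alternating l \<Longrightarrow> x \<in> set l \<Longrightarrow> 0 < x"
  by (induction l rule: alternating.induct) auto

lemma alternating_all_1:
  assumes "alternating l" and "\<not> (\<exists>x \<in> set l. 2 \<le> x)"
  shows "l = replicate (length l) 1"
proof (rule replicate_eqI)
  fix x assume "x \<in> set l"
  with assms alternating_pos[of l x] show "x = 1" by fastforce
qed simp

text \<open>The opponent only meets forced removals, so the player to move can remove entries until
  a last entry \<open>\<ge> 2\<close> is reached and fix the parity there. If all entries are 1, odd
  length alone decides.\<close>

lemma lwin_alternating:
  assumes "alternating l" and "odd (length l) \<or> (\<exists>x \<in> set l. 2 \<le> x)"
  shows "lwin l"
  using assms
proof (induction l rule: alternating.induct)
  case 1
  then show ?case by simp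
next
  case (2 x)
  then show ?case by (auto intro: lwin_remove llose_Nil)
next
  case (3 x y l)
  then have xy: "0 < x" "y = 1" and l: "alternating l" by auto
  show ?case
  proof (cases "odd (length l) \<and> x = 1 \<or> (\<exists>z \<in> set l. 2 \<le> z)")
    case True
    with 3 l have "lwin l" by blast
    with xy show ?thesis by (auto intro!: lwin_remove llose_Cons_1[simplified])
  next
    case False
    with 3 have x: "2 \<le> x" by auto
    define n where "n = length l"
    have l1: "l = replicate n 1" using alternating_all_1[OF l] False by (auto simp: n_def)
    show ?thesis
    \<comment> \<open>Only \<open>x\<close> offers a choice: removing it leaves \<open>n + 1\<close>
      ones, reducing it to 1 leaves \<open>n + 2\<close>. The even number is chosen.\<close>
    proof (cases "odd n")
      case True
      then have "llose (replicate (Suc n) 1)" by (intro replicate_1) simp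
      with x xy l1 show ?thesis by (auto intro: lwin_remove)
    next
      case False
      then have "llose (replicate (Suc (Suc n)) 1)" by (intro replicate_1) simp
      also have "replicate (Suc (Suc n)) 1 = (y # l) @ [1]"
        using xy l1 by (simp add: replicate_append_same)
      finally show ?thesis using x by (auto intro: lwin_decrease)
    qed
  qed
qed

text \<open>Induction takes a pair off the block, while \<open>cs\<close> collects what both players
  leave behind. The forced removal of the separating 1 shifts ownership: the entries kept by the
  player to move fall to the opponent, and the opponent's ones fall to the player.\<close>

lemma llose_even_block:
  assumes "even (length bs)" "bs \<noteq> []" "\<forall>b \<in> set bs. 2 \<le> b"
    and "alternating cs" "even (length cs)"
  shows "llose (bs @ 1 # cs)"
  using assms
proof (induction bs arbitrary: cs rule: induct_list012)
  case (3 x y bs)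
  have y: "2 \<le> y" using 3 by simp
  have kept: "lwin ((y # bs @ 1 # cs) @ [k])" if "0 < k" for k
  proof (cases "bs = []")
    case True
    show ?thesis
    \<comment> \<open>This is the last answer. After the forced removal, \<open>cs @ [k]\<close>
      wins by its odd length and \<open>cs @ [k, 1]\<close> by its entry
      \<open>k \<ge> 2\<close>.\<close>
    proof (cases "k = 1")
      case True
      have "lwin (cs @ [k])"
        using 3 that by (intro lwin_alternating alternating_append) auto
      then have "llose (1 # cs @ [k])" by (rule llose_Cons_1)
      then show ?thesis using y \<open>bs = []\<close> by (auto intro: lwin_remove)
    next
      case False
      have "lwin (cs @ [k, 1])"
        using 3 that False by (intro lwin_alternating alternating_append) auto
      then have "llose (1 # cs @ [k, 1])" by (rule llose_Cons_1)
      then show ?thesis using y \<open>bs = []\<close> by (auto intro: lwin_decrease[of _ 1])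
    qed
  next
    case False
    have "llose (bs @ 1 # cs @ [k, 1])"
      using 3 that False by (intro "3.IH") (auto intro: alternating_append)
    then show ?thesis using y by (auto intro: lwin_decrease[of _ 1])
  qed
  have removed: "lwin (y # bs @ 1 # cs)"
  proof (cases "bs = []")
    case True
    \<comment> \<open>Here the last answer to a removal is to leave 1, which makes the remaining
      list odd.\<close>
    have "lwin (cs @ [1])"
      using 3 by (intro lwin_alternating alternating_append) auto
    then have "llose (1 # cs @ [1])" by (rule llose_Cons_1)
    then show ?thesis using y True by (auto intro: lwin_decrease[of _ 1])
  next
    case False
    have "llose (bs @ 1 # cs)" using 3 False by (intro "3.IH") auto
    then show ?thesis using y by (auto intro: lwin_remove)
  qed
  show ?case using llose_Cons[OF kept removed] by simp
qed auto

lemma lwin_odd_ge_2: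
  assumes "odd (length l)" "3 \<le> length l" "\<forall>a \<in> set l. 2 \<le> a"
  shows "lwin l"
proof -
  obtain a as where l: "l = a # as" using assms by (cases l) auto
  with assms have "llose (as @ [1])" by (intro llose_even_block) auto
  with l assms show ?thesis by (auto intro: lwin_decrease[of _ 1])
qed

text \<open>This refutes leaving 1 in an even list: removing the first entry restores the shape of
  \<open>llose_even_block\<close>.\<close>

lemma lwin_odd_block_1:
  assumes "odd (length l)" "3 \<le> length l" "\<forall>a \<in> set l. 2 \<le> a"
  shows "lwin (l @ [1])"
proof -
  obtain a as where l: "l = a # as" using assms by (cases l) auto
  with assms have "llose (as @ [1])" by (intro llose_even_block) auto
  with l assms show ?thesis by (auto intro: lwin_remove)
qed

section \<open>Even lists and the leftmost minimum\<close>

definition leftmost_min :: "nat list \<Rightarrow> nat \<Rightarrow> bool" where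
  "leftmost_min l m \<longleftrightarrow>
     m < length l \<and> (\<forall>i < m. l ! m < l ! i) \<and> (\<forall>i < length l. l ! m \<le> l ! i)"

text \<open>A tie with the appended \<open>k\<close> is harmless, since \<open>k\<close> stands to
  the right of the old minimum.\<close>

lemma leftmost_min_rotate:
  assumes "leftmost_min (a # l) (Suc m)" and "l ! m \<le> k"
  shows "leftmost_min (l @ [k]) m"
proof -
  have "m < length l" "\<And>i. i < m \<Longrightarrow> l ! m < l ! i" "\<And>i. i < length l \<Longrightarrow> l ! m \<le> l ! i"
    using assms(1) unfolding leftmost_min_def by auto
  with assms(2) show ?thesis
    by (auto simp: leftmost_min_def nth_append less_Suc_eq)
qed

lemma leftmost_min_last:
  assumes "leftmost_min (a # l) m" and "k < (a # l) ! m"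
  shows "leftmost_min (l @ [k]) (length l)"
proof -
  have "(a # l) ! m \<le> l ! i" if "i < length l" for i
    using assms(1) that unfolding leftmost_min_def by auto
  with assms(2) show ?thesis
    by (fastforce simp: leftmost_min_def nth_append less_Suc_eq)
qed

text \<open>As long as nobody removes, even indices belong to the player to move. The claim is that
  owning the leftmost minimum loses; the induction is on the total weight.\<close>

lemma even_outcome:
  assumes "even (length l)" "4 \<le> length l" "\<forall>a \<in> set l. 2 \<le> a" "leftmost_min l m"
  shows "(odd m \<longrightarrow> lwin l) \<and> (even m \<longrightarrow> llose l)"
  using assms
proof (induction "sum_list l" arbitrary: l m rule: less_induct)
  case less
  obtain a as where l: "l = a # as" using less.prems by (cases l) auto
  have IH: "(odd j \<longrightarrow> lwin (as @ [k])) \<and> (even j \<longrightarrow> llose (as @ [k]))"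
    if "2 \<le> k" "k < a" "leftmost_min (as @ [k]) j" for j k
    using less.prems that l by (intro less.hyps) auto
  have "lwin l" if "odd m"
  proof -
    from that obtain j where m: "m = Suc j" by (cases m) auto
    \<comment> \<open>Leftmostness at index 0 makes \<open>a\<close> strictly exceed the minimum, so
      \<open>a - 1\<close> neither undercuts it nor drops below 2.\<close>
    have j: "j < length as" "as ! j < a" "2 \<le> as ! j"
      using less.prems unfolding leftmost_min_def l m by (auto dest!: spec[of _ 0])
    then have "leftmost_min (as @ [a - 1]) j"
      using less.prems unfolding l m by (intro leftmost_min_rotate) auto
    with IH[of "a - 1" j] j that m have "llose (as @ [a - 1])" by auto
    then show ?thesis unfolding l using j by (auto intro: lwin_decrease)
  qed
  moreover have "llose l" if "even m"
    unfolding l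
  proof (rule llose_Cons)
    show "lwin as" using less.prems l by (intro lwin_odd_ge_2) auto
    fix k assume k: "0 < k" "k < a"
    \<comment> \<open>Undercutting the minimum puts the new one at the last index, which is odd;
      otherwise the old one shifts from an even to an odd index. Either way the opponent
      wins.\<close>
    consider "k = 1" | "2 \<le> k" "k < l ! m" | "2 \<le> k" "l ! m \<le> k" using k by linarith
    then show "lwin (as @ [k])"
    proof cases
      case 1
      then show ?thesis using less.prems l lwin_odd_block_1[of as] by auto
    next
      case 2
      then have "leftmost_min (as @ [k]) (length as)"
        using less.prems l by (intro leftmost_min_last) auto
      with IH 2 k less.prems(1) l show ?thesis by auto
    next
      case 3
      \<comment> \<open>At index 0 the minimum would be \<open>a\<close> itself, and
        \<open>k < a\<close>.\<close>
      with k l have "m \<noteq> 0" by (cases m) auto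
      then obtain j where m: "m = Suc j" by (cases m) auto
      with 3 l less.prems have "leftmost_min (as @ [k]) j"
        by (intro leftmost_min_rotate) auto
      with IH 3 k that m show ?thesis by auto
    qed
  qed
  ultimately show ?case by blast
qed

section \<open>Circuits as lists\<close>

text \<open>A singleton list yields a vertex with a loop, as contraction does when one of two
  vertices is removed.\<close>

definition cyc :: "'v list \<Rightarrow> 'v pair_pre_digraph" where
  "cyc vs = \<lparr> pverts = set vs, parcs = set (zip vs (rotate1 vs)) \<rparr>"

lemma cyc_Cons:
  "parcs (cyc (v # vs)) = set (zip (v # vs) (vs @ [v]))"
  by (simp add: cyc_def)

lemma set_zip_tl_snoc:
  "set (zip (u # us @ [z]) (us @ [z, v])) = insert (z, v) (set (zip (u # us) (us @ [z])))"
  using zip_append[of "u # us" "us @ [z]" "[z]" "[v]"] by simp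

lemma cyc_rotate: "cyc (vs @ [v]) = cyc (v # vs)"
proof (cases vs)
  case (Cons u us)
  then show ?thesis using set_zip_tl_snoc[of u us v u] by (auto simp: cyc_def)
qed simp

lemma cyc_succ:
  assumes "distinct (v # vs)"
  shows "(v, s) \<in> parcs (cyc (v # vs)) \<longleftrightarrow> s = hd (vs @ [v])"
  using assms by (cases vs) (auto simp: cyc_def dest: set_zip_leftD)

lemma remove_vertex_cyc:
  assumes "distinct (v # vs)"
  shows "remove_vertex v (cyc (v # vs)) = cyc vs"
proof (cases vs rule: rev_cases)
  case Nil
  then show ?thesis by (auto simp: remove_vertex_def cyc_def)
next
  case (snoc us z)
  show ?thesis
  proof (cases us)
    case Nil
    then show ?thesis using snoc assms by (auto simp: remove_vertex_def cyc_def)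
  next
    case (Cons u us')
    \<comment> \<open>Both circuits share the path from \<open>u\<close> to \<open>z\<close>;
      contraction replaces the detour through \<open>v\<close> by the arc
      \<open>(z, u)\<close>.\<close>
    have A: "parcs (cyc (v # vs)) = insert (v, u) (insert (z, v) (set (zip us (us' @ [z]))))"
      using snoc Cons set_zip_tl_snoc[of u us' z v] by (auto simp: cyc_def)
    have B: "parcs (cyc vs) = insert (z, u) (set (zip us (us' @ [z])))"
      using snoc Cons set_zip_tl_snoc[of u us' z u] by (auto simp: cyc_def)
    have "p \<noteq> v" "s \<noteq> v" if "(p, s) \<in> set (zip us (us' @ [z]))" for p s
      using set_zip_leftD[OF that] set_zip_rightD[OF that] assms snoc Cons by auto
    moreover have "u \<noteq> v" "z \<noteq> v" using assms snoc Cons by auto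
    moreover have "pverts (cyc (v # vs)) - {v} = pverts (cyc vs)"
      using assms by (auto simp: cyc_def)
    ultimately show ?thesis
      unfolding remove_vertex_def A by (intro pair_pre_digraph.equality) (auto simp: B)
  qed
qed

text \<open>The field \<open>current\<close> is unconstrained on the empty circuit, where it is meaningless.\<close>

definition represents :: "'v position \<Rightarrow> nat list \<Rightarrow> bool" where
  "represents x l \<longleftrightarrow>
     (\<exists>vs. distinct vs \<and> graph x = cyc vs \<and> map (weight x) vs = l \<and>
        (vs \<noteq> [] \<longrightarrow> current x = hd vs))"

text \<open>Together with \<open>move_if_lstep\<close> this makes \<open>represents\<close> a
  bisimulation. The new vertex order is \<open>us @ [v]\<close> after a decrease and
  \<open>us\<close> after a removal.\<close>

lemma lstep_if_move:
  assumes "represents x l" and "move x y"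
  shows "\<exists>l'. lstep l l' \<and> represents y l'"
proof -
  obtain vs where vs: "distinct vs" "graph x = cyc vs" "map (weight x) vs = l"
    "vs \<noteq> [] \<longrightarrow> current x = hd vs"
    using assms(1) by (auto simp: represents_def)
  have "vs \<noteq> []" using not_game_over_if_move[OF assms(2)] vs(2) by (auto simp: game_over_def cyc_def)
  then obtain v us where v: "vs = v # us" by (cases vs) auto
  have upd: "map ((weight x)(v := k)) us = map (weight x) us" for k
    using vs v by auto
  have l: "l = weight x v # map (weight x) us" using vs v by simp
  from assms(2) show ?thesis
  proof cases
    case (decrease u G k w t)
    then have eqs: "u = v" "weight x = w" "G = cyc (v # us)" using vs v by auto
    have "represents y (map w us @ [k])"
      unfolding represents_def
      using decrease(2-) eqs vs(1) v upd cyc_succ[of v us t]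
      by (intro exI[of _ "us @ [v]"]) (auto simp: cyc_rotate)
    then show ?thesis using decrease(2-) eqs l by (auto intro: lstep_decrease)
  next
    case (remove u G w t)
    then have eqs: "u = v" "weight x = w" "G = cyc (v # us)" using vs v by auto
    have "represents y (map w us)"
      unfolding represents_def
      using remove(2-) eqs vs(1) v upd cyc_succ[of v us t]
      by (intro exI[of _ us]) (auto simp: remove_vertex_cyc)
    then show ?thesis using remove(2-) eqs l by (auto intro: lstep_remove)
  next
    case (remove_last G u w)
    then have eqs: "u = v" "weight x = w" "G = cyc (v # us)" using vs v by auto
    have "us = []" using remove_last(2-) eqs vs(1) v by (cases us) (auto simp: cyc_def)
    then have "represents y []"
      unfolding represents_def
      using remove_last(2-) eqs remove_vertex_cyc[of v "[]"] by (intro exI[of _ "[]"]) auto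
    then show ?thesis using remove_last(2-) eqs l \<open>us = []\<close> by (auto intro: lstep_remove)
  qed
qed

lemma move_if_lstep:
  assumes "represents x l" and "lstep l l'"
  shows "\<exists>y. move x y \<and> represents y l'"
proof -
  obtain vs where vs: "distinct vs" "graph x = cyc vs" "map (weight x) vs = l"
    "vs \<noteq> [] \<longrightarrow> current x = hd vs"
    using assms(1) by (auto simp: represents_def)
  have "l \<noteq> []" using assms(2) by (auto elim: lstep.cases)
  then obtain v us where v: "vs = v # us" using vs by (cases vs) auto
  have upd: "map ((weight x)(v := k)) us = map (weight x) us" for k
    using vs v by auto
  have l: "l = weight x v # map (weight x) us" using vs v by simp
  have x: "x = \<lparr> graph = cyc (v # us), weight = weight x, current = v \<rparr>"
    using vs v by simp
  have vin: "v \<in> pverts (cyc (v # us))" by (simp add: cyc_def)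
  have d: "distinct (v # us)" using vs v by simp
  from assms(2) show ?thesis
  proof cases
    case (lstep_decrease k a as)
    let ?y = "\<lparr> graph = cyc (v # us), weight = (weight x)(v := k), current = hd (us @ [v]) \<rparr>"
    have "move x ?y"
      by (subst x, rule move.decrease) (use lstep_decrease l vin cyc_succ[OF d] in auto)
    moreover have "represents ?y l'"
      unfolding represents_def using lstep_decrease l d upd
      by (intro exI[of _ "us @ [v]"]) (auto simp: cyc_rotate)
    ultimately show ?thesis by blast
  next
    case (lstep_remove a)
    \<comment> \<open>For \<open>us = []\<close> the head is \<open>v\<close>, as
      \<open>move.remove_last\<close> prescribes.\<close>
    let ?y = "\<lparr> graph = remove_vertex v (cyc (v # us)), weight = (weight x)(v := 0),
                current = hd (us @ [v]) \<rparr>"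
    have "move x ?y"
    proof (cases us)
      case Nil
      show ?thesis
        by (subst x, simp add: Nil, rule move.remove_last)
          (use lstep_remove l in \<open>auto simp: cyc_def\<close>)
    next
      case (Cons u us')
      show ?thesis
        by (subst x, rule move.remove)
          (use lstep_remove l vin d cyc_succ[OF d] Cons in auto)
    qed
    moreover have "represents ?y l'"
      unfolding represents_def using lstep_remove l d upd
      by (intro exI[of _ us]) (auto simp: remove_vertex_cyc)
    ultimately show ?thesis by blast
  qed
qed

lemma outcome_if_represents:
  "lwin l \<Longrightarrow> represents x l \<Longrightarrow> N_position x"
  "llose l \<Longrightarrow> represents x l \<Longrightarrow> P_position x"
proof (induction arbitrary: x and x rule: lwin_llose.inducts)
  case (lwinI l l')
  then show ?case using move_if_lstep N_position_iff by blast
next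
  case (lloseI l)
  then show ?case using lstep_if_move P_position_iff by blast
qed

lemma finite_pverts_move:
  "move x y \<Longrightarrow> finite (pverts (graph x)) \<Longrightarrow> finite (pverts (graph y))"
  by (induction rule: move.induct) (auto simp: remove_vertex_def)

text \<open>A winning move from such a position would lead to one of smaller total weight that is
  again both P and N.\<close>

lemma not_N_position_if_P_position:
  assumes "finite (pverts (graph x))" and "P_position x"
  shows "\<not> N_position x"
  using assms
proof (induction "sum (weight x) (pverts (graph x))" arbitrary: x rule: less_induct)
  case less
  then show ?case
    using N_position_iff P_position_iff move_weight_less finite_pverts_move by metis
qed

lemma represents_adjacent_nim:
  assumes "1 \<le> N"
  shows "represents (adjacent_nim N w) (map w [1..<Suc N])"
proof -
  have split: "[1..<Suc N] = 1 # [2..<Suc N]"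
    using assms by (simp add: upt_conv_Cons numeral_2_eq_2)
  \<comment> \<open>Index \<open>i\<close> stands for vertex \<open>i + 1\<close>; index
    \<open>N - 1\<close> wraps around to vertex 1.\<close>
  have nth: "([2..<Suc N] @ [1]) ! i = (if i < N - 1 then i + 2 else 1)" if "i < N" for i
    using that by (cases "N = 1") (auto simp: nth_append)
  have "parcs (cyc [1..<Suc N]) = {([1..<Suc N] ! i, ([2..<Suc N] @ [1]) ! i) | i. i < N}"
    using assms unfolding split cyc_Cons set_zip by (simp del: upt_Suc)
  also have "\<dots> = {(i + 1, if i < N - 1 then i + 2 else 1) | i. i < N}"
  proof (intro Collect_cong ex_cong1)
    fix e :: "nat \<times> nat" and i
    show "e = ([1..<Suc N] ! i, ([2..<Suc N] @ [1]) ! i) \<and> i < N \<longleftrightarrow>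
      e = (i + 1, if i < N - 1 then i + 2 else 1) \<and> i < N"
      by (cases "i < N") (simp_all add: nth add.commute del: upt_Suc One_nat_def)
  qed
  also have "\<dots> = parcs (circuit N)"
  proof (rule set_eqI)
    fix e :: "nat \<times> nat"
    have "(\<exists>i. e = (i + 1, if i < N - 1 then i + 2 else 1) \<and> i < N) \<longleftrightarrow>
      (\<exists>i. e = (i, i + 1) \<and> 1 \<le> i \<and> i < N) \<or> e = (N, 1)" (is "?L \<longleftrightarrow> ?R")
    proof
      assume ?L
      then show ?R by (auto split: if_splits)
    next
      assume ?R
      then show ?L
      proof (elim disjE exE conjE)
        fix i assume "e = (i, i + 1)" "1 \<le> i" "i < N"
        then show ?L by (intro exI[of _ "i - 1"]) auto
      next
        assume "e = (N, 1)"
        then show ?L using assms by (intro exI[of _ "N - 1"]) auto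
      qed
    qed
    then show "e \<in> {(i + 1, if i < N - 1 then i + 2 else 1) | i. i < N} \<longleftrightarrow> e \<in> parcs (circuit N)"
      by (auto simp: circuit_def)
  qed
  finally have "circuit N = cyc [1..<Suc N]"
    by (intro pair_pre_digraph.equality) (auto simp: circuit_def cyc_def)
  then show ?thesis
    unfolding represents_def
    by (intro exI[of _ "[1..<Suc N]"]) (auto simp: adjacent_nim_def split simp del: upt_Suc)
qed

text \<open>Vertices count from 1 and list indices from 0. The bound \<open>1 \<le> Min S\<close>
  rules out truncated subtraction, so the shift flips parity.\<close>

lemma leftmost_min_Min_arg_min:
  fixes w :: "nat \<Rightarrow> nat"
  assumes "1 \<le> N"
  defines "S \<equiv> {i. is_arg_min w (\<lambda>j. j \<in> {1..N}) i}"
  shows "leftmost_min (map w [1..<Suc N]) (Min S - 1)" and "1 \<le> Min S"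
proof -
  have S: "i \<in> S \<longleftrightarrow> i \<in> {1..N} \<and> (\<forall>j \<in> {1..N}. w i \<le> w j)" for i
    by (auto simp: S_def is_arg_min_linorder)
  have "finite S" by (rule finite_subset[of _ "{1..N}"]) (auto simp: S)
  moreover have "S \<noteq> {}"
    using ex_is_arg_min_if_finite[of "{1..N}" w] assms(1) by (auto simp: S_def)
  ultimately have M: "Min S \<in> S" "\<And>i. i \<in> S \<Longrightarrow> Min S \<le> i" by auto
  then show "1 \<le> Min S" using S by auto
  have "w (Min S) < w i" if "1 \<le> i" "i < Min S" for i
  proof (rule ccontr)
    assume "\<not> w (Min S) < w i"
    with that M(1) have "i \<in> S" unfolding S by fastforce
    with M(2) that show False by fastforce
  qed
  with M(1) show "leftmost_min (map w [1..<Suc N]) (Min S - 1)"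
    unfolding leftmost_min_def S by (auto simp del: upt_Suc)
qed

theorem theorem1:
  fixes N :: nat and w :: "nat \<Rightarrow> nat"
  assumes "N \<ge> 3" and "\<forall>i \<in> {1..N}. w i > 1"
  shows "(odd N \<longrightarrow> N_position (adjacent_nim N w)) \<and>
         (even N \<longrightarrow>
           (N_position (adjacent_nim N w) \<longleftrightarrow>
              even (Min {i. is_arg_min w (\<lambda>j. j \<in> {1..N}) i})))"
proof -
  define l where "l = map w [1..<Suc N]"
  define m where "m = Min {i. is_arg_min w (\<lambda>j. j \<in> {1..N}) i}"
  have rep: "represents (adjacent_nim N w) l"
    unfolding l_def using assms by (intro represents_adjacent_nim) simp
  have len: "length l = N" by (simp add: l_def)
  have ge: "\<forall>a \<in> set l. 2 \<le> a" using assms(2) by (auto simp: l_def numeral_2_eq_2 Suc_le_eq simp del: upt_Suc)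
  have m: "leftmost_min l (m - 1)" "1 \<le> m"
    unfolding l_def m_def using leftmost_min_Min_arg_min[of N w] assms(1) by auto
  have "N_position (adjacent_nim N w)" if "odd N"
    using lwin_odd_ge_2[of l] that len ge assms(1) outcome_if_represents(1)[OF _ rep] by auto
  moreover have "N_position (adjacent_nim N w) \<longleftrightarrow> even m" if "even N"
  proof -
    \<comment> \<open>Four entries leave a tail of at least three, as the odd case requires.\<close>
    have "4 \<le> N" using that assms(1) by (cases "N = 3") auto
    then have out: "(odd (m - 1) \<longrightarrow> lwin l) \<and> (even (m - 1) \<longrightarrow> llose l)"
      using that len ge m by (intro even_outcome) auto
    have fin: "finite (pverts (graph (adjacent_nim N w)))"
      by (simp add: adjacent_nim_def circuit_def)
    show ?thesis
      using out m(2) outcome_if_represents[OF _ rep] not_N_position_if_P_position[OF fin]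
      by (cases "even m") auto
  qed
  ultimately show ?thesis unfolding m_def by blast
qed

end
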